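(* Let $G$ be a $k$ resistance regular graph of order $n$. Then for all vertices $i,j$ of $G$, $$L_{ij}^+(G)=\frac12\left(\frac kn-\frac{s_{ij}}{t}\right),$$ where $t$ is the number of spanning trees in $G$ and $s_{ij}$ is the number of spanning 2-forests in $G$ separating $i$ and $j$.
   Context: All graphs are finite, simple, undirected and connected. The resistance distance $r_{ij}$ is the effective resistance between vertices $i$ and $j$ when each edge of $G$ carries a unit resistance; equivalently (known fact) $r_{ij}=L_{ii}^++L_{jj}^+-2L_{ij}^+$, where $L^+=L^+(G)$ is the Moore-Penrose inverse of the Laplacian matrix $L=D-A$ of $G$. The resistance matrix is $R(G)=(r_{ij})$. A connected graph $G$ is $k$ resistance regular if all row sums of $R(G)$ are equal to $k$. A $2$-forest is a union of two disjoint trees; a spanning $2$-forest of $G$ separates $i$ and $j$ if $i$ and $j$ lie in different components of it (so $s_{ii}=0$). *)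

theory Defs
  imports "HOL-Analysis.Analysis"
begin

section \<open>Finite simple undirected graphs\<close>

text \<open>A graph is a vertex set together with a set of two-element edges \<open>{x, y}\<close>.\<close>

definition simple_graph :: "'a set \<Rightarrow> 'a set set \<Rightarrow> bool" where
  "simple_graph V E \<longleftrightarrow> finite V \<and> (\<forall>e\<in>E. e \<subseteq> V \<and> card e = 2)"

definition adjacent :: "'a set set \<Rightarrow> 'a \<Rightarrow> 'a \<Rightarrow> bool" where
  "adjacent E x y \<longleftrightarrow> {x, y} \<in> E"

definition reachable :: "'a set set \<Rightarrow> 'a \<Rightarrow> 'a \<Rightarrow> bool" where
  "reachable E = (adjacent E)\<^sup>*\<^sup>*"

definition connected_graph :: "'a set \<Rightarrow> 'a set set \<Rightarrow> bool" where
  "connected_graph V E \<longleftrightarrow>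
     simple_graph V E \<and> V \<noteq> {} \<and> (\<forall>x\<in>V. \<forall>y\<in>V. reachable E x y)"

text \<open>A cycle is given by the list of its (distinct) vertices; the closing edge joins the
  last vertex to the first.\<close>

definition is_cycle :: "'a set set \<Rightarrow> 'a list \<Rightarrow> bool" where
  "is_cycle E c \<longleftrightarrow>
     length c \<ge> 3 \<and> distinct c \<and> successively (adjacent E) c \<and> adjacent E (last c) (hd c)"

definition is_tree :: "'a set \<Rightarrow> 'a set set \<Rightarrow> bool" where
  "is_tree V E \<longleftrightarrow> connected_graph V E \<and> (\<nexists>c. is_cycle E c)"

definition two_forest :: "'a set \<Rightarrow> 'a set set \<Rightarrow> bool" where
  "two_forest V F \<longleftrightarrow>
     (\<exists>V1 V2 F1 F2. is_tree V1 F1 \<and> is_tree V2 F2 \<and> V1 \<inter> V2 = {} \<and>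
        V = V1 \<union> V2 \<and> F = F1 \<union> F2)"

text \<open>Spanning subgraphs keep all vertices, hence are determined by their edge sets.\<close>

definition spanning_trees :: "'a set \<Rightarrow> 'a set set \<Rightarrow> 'a set set set" where
  "spanning_trees V E = {F. F \<subseteq> E \<and> is_tree V F}"

definition separating_two_forests ::
    "'a set \<Rightarrow> 'a set set \<Rightarrow> 'a \<Rightarrow> 'a \<Rightarrow> 'a set set set" where
  "separating_two_forests V E i j =
     {F. F \<subseteq> E \<and> two_forest V F \<and> \<not> reachable F i j}"

section \<open>Laplacian matrix and Moore--Penrose inverse\<close>

text \<open>From here on the vertex set is all of the finite index type of the matrices.\<close>

definition degree_matrix :: "'n::finite set set \<Rightarrow> real^'n^'n" where
  "degree_matrix E = (\<chi> x y. if x = y then real (card {z. adjacent E x z}) else 0)"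

definition adjacency_matrix :: "'n::finite set set \<Rightarrow> real^'n^'n" where
  "adjacency_matrix E = (\<chi> x y. if adjacent E x y then 1 else 0)"

definition laplacian :: "'n::finite set set \<Rightarrow> real^'n^'n" where
  "laplacian E = degree_matrix E - adjacency_matrix E"

definition is_moore_penrose :: "real^'n^'m \<Rightarrow> real^'m^'n \<Rightarrow> bool" where
  "is_moore_penrose A X \<longleftrightarrow>
     A ** X ** A = A \<and> X ** A ** X = X \<and>
     transpose (A ** X) = A ** X \<and> transpose (X ** A) = X ** A"

definition moore_penrose :: "real^'n^'m \<Rightarrow> real^'m^'n" where
  "moore_penrose A = (THE X. is_moore_penrose A X)"

section \<open>Resistance distance\<close>

text \<open>Unit resistors on all edges and a unit current entering at \<open>i\<close> and leaving at \<open>j\<close>: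
  by Ohm's law the current from \<open>x\<close> to a neighbour \<open>y\<close> is \<open>v x - v y\<close>, and the equation is
  Kirchhoff's current law. The effective resistance is the potential difference between
  \<open>i\<close> and \<open>j\<close>; in a connected graph it does not depend on the choice of \<open>v\<close>.\<close>

definition unit_current_potential ::
    "'n::finite set set \<Rightarrow> 'n \<Rightarrow> 'n \<Rightarrow> ('n \<Rightarrow> real) \<Rightarrow> bool" where
  "unit_current_potential E i j v \<longleftrightarrow>
     (\<forall>x. (\<Sum>y | adjacent E x y. v x - v y) =
          (if x = i then 1 else 0) - (if x = j then 1 else 0))"

definition resistance_distance :: "'n::finite set set \<Rightarrow> 'n \<Rightarrow> 'n \<Rightarrow> real" where
  "resistance_distance E i j =
     (THE r. \<exists>v. unit_current_potential E i j v \<and> r = v i - v j)"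

definition resistance_matrix :: "'n::finite set set \<Rightarrow> real^'n^'n" where
  "resistance_matrix E = (\<chi> i j. resistance_distance E i j)"

definition resistance_regular :: "real \<Rightarrow> 'n::finite set set \<Rightarrow> bool" where
  "resistance_regular k E \<longleftrightarrow>
     connected_graph UNIV E \<and> (\<forall>i. (\<Sum>j\<in>UNIV. resistance_matrix E $ i $ j) = k)"

end

theory Submission
  imports Defs
begin

text \<open>Kirchhoff's combinatorial potential: let \<open>v x\<close> be the number of spanning 2-forests separating
  \<open>i\<close> and \<open>j\<close> in which \<open>x\<close> lies on the side of \<open>i\<close>, divided by \<open>t\<close>. Adding the edge \<open>xy\<close> turns the
  forests with \<open>x\<close> on the side of \<open>i\<close> and \<open>y\<close> on the side of \<open>j\<close> into the spanning trees whose path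
  from \<open>i\<close> to \<open>j\<close> traverses \<open>xy\<close> in this direction. So \<open>v x - v y\<close> is the average, over all
  spanning trees, of the unit flow from \<open>i\<close> to \<open>j\<close> in the tree, and \<open>v\<close> obeys Kirchhoff's current
  law, which gives \<open>r\<^sub>i\<^sub>j = s\<^sub>i\<^sub>j / t\<close>. On the other hand \<open>r\<^sub>i\<^sub>j = L\<^sup>+\<^sub>i\<^sub>i + L\<^sup>+\<^sub>j\<^sub>j - 2 L\<^sup>+\<^sub>i\<^sub>j\<close>, where the rows of
  \<open>L\<^sup>+\<close> sum to zero. Summing over \<open>j\<close> shows that resistance regularity forces
  \<open>L\<^sup>+\<^sub>i\<^sub>i = k / (2 n)\<close> for all \<open>i\<close>.\<close>

section \<open>Reachability and acyclic edge sets\<close>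

lemma adjacent_commute: "adjacent E x y \<longleftrightarrow> adjacent E y x"
  by (simp add: adjacent_def insert_commute)

lemma reachable_refl [simp]: "reachable E x x"
  by (simp add: reachable_def)

lemma reachable_trans: "reachable E x y \<Longrightarrow> reachable E y z \<Longrightarrow> reachable E x z"
  by (simp add: reachable_def)

lemma reachable_sym: "reachable E x y \<Longrightarrow> reachable E y x"
  unfolding reachable_def
  by (metis adjacent_commute sympD sympI symp_rtranclp)

lemma reachable_edge: "{x, y} \<in> E \<Longrightarrow> reachable E x y"
  by (simp add: reachable_def adjacent_def r_into_rtranclp)

lemma reachable_mono:
  assumes "E \<subseteq> F" "reachable E x y"
  shows "reachable F x y"
proof -
  have "adjacent E \<le> adjacent F"
    using assms(1) by (auto simp: adjacent_def)
  then show ?thesis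
    using assms(2) unfolding reachable_def by (metis rtranclp_mono predicate2D)
qed

text \<open>A walk can be shortened until it crosses the new edge at most once; the alternatives are
  no crossing, a crossing from \<open>x\<close> to \<open>y\<close>, and one from \<open>y\<close>
  to \<open>x\<close>.\<close>

lemma reachable_insert_cases:
  assumes "reachable (insert {x, y} F) a b"
  shows "reachable F a b \<or> (reachable F a x \<and> reachable F y b) \<or>
    (reachable F a y \<and> reachable F x b)"
  using assms unfolding reachable_def
proof (induction rule: rtranclp_induct)
  case base
  then show ?case by simp
next
  case (step b c)
  have "adjacent F b c \<or> (b = x \<and> c = y) \<or> (b = y \<and> c = x)"
    using step.hyps(2) by (auto simp: adjacent_def doubleton_eq_iff)
  with step.IH show ?case
    by (metis rtranclp.rtrancl_into_rtrancl rtranclp.rtrancl_refl)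
qed

lemma reachable_remove_cases:
  assumes "reachable F a b"
  shows "reachable (F - {{x, y}}) a b \<or>
    (reachable (F - {{x, y}}) a x \<and> reachable (F - {{x, y}}) y b) \<or>
    (reachable (F - {{x, y}}) a y \<and> reachable (F - {{x, y}}) x b)"
proof (rule reachable_insert_cases)
  show "reachable (insert {x, y} (F - {{x, y}})) a b"
    using assms by (rule reachable_mono[rotated]) auto
qed

text \<open>Every edge is a bridge. This form of acyclicity suits insertion and deletion of single
  edges better than cycles given as vertex lists; \<open>no_cycle_iff_acyclic_edges\<close> links
  the two.\<close>

definition acyclic_edges :: "'a set set \<Rightarrow> bool" where
  "acyclic_edges F \<longleftrightarrow> (\<forall>x y. {x, y} \<in> F \<longrightarrow> \<not> reachable (F - {{x, y}}) x y)"

lemma acyclic_edgesD: "acyclic_edges F \<Longrightarrow> {x, y} \<in> F \<Longrightarrow> \<not> reachable (F - {{x, y}}) x y"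
  by (simp add: acyclic_edges_def)

lemma acyclic_edges_subset:
  assumes "acyclic_edges F" "G \<subseteq> F"
  shows "acyclic_edges G"
  unfolding acyclic_edges_def
proof (intro allI impI)
  fix x y assume "{x, y} \<in> G"
  then have "\<not> reachable (F - {{x, y}}) x y"
    using assms by (auto dest: acyclic_edgesD)
  then show "\<not> reachable (G - {{x, y}}) x y"
    using assms(2) by (meson Diff_mono order_refl reachable_mono)
qed

text \<open>The new edge joins two components, so it is a bridge. If an old edge
  \<open>{a, b}\<close> stopped being one, the detour around it would cross the new edge, and its
  remaining pieces together with \<open>{a, b}\<close> would connect \<open>x\<close> and
  \<open>y\<close> inside \<open>F\<close>.\<close>

lemma acyclic_edges_insert:
  assumes "acyclic_edges F" "\<not> reachable F x y"
  shows "acyclic_edges (insert {x, y} F)"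
  unfolding acyclic_edges_def
proof (intro allI impI notI)
  fix a b
  assume ab: "{a, b} \<in> insert {x, y} F" and r: "reachable (insert {x, y} F - {{a, b}}) a b"
  have xyF: "{x, y} \<notin> F"
    using assms(2) reachable_edge by metis
  show False
  proof (cases "{a, b} = {x, y}")
    case True
    then have "reachable F a b"
      using r xyF by auto
    then show False
      using True assms(2) by (metis doubleton_eq_iff reachable_sym)
  next
    case False
    then have abF: "{a, b} \<in> F" using ab by simp
    have "insert {x, y} F - {{a, b}} = insert {x, y} (F - {{a, b}})"
      using False by auto
    then have "reachable (F - {{a, b}}) a b \<or>
      (reachable (F - {{a, b}}) a x \<and> reachable (F - {{a, b}}) y b) \<or>
      (reachable (F - {{a, b}}) a y \<and> reachable (F - {{a, b}}) x b)"
      using r reachable_insert_cases by metis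
    then have "(reachable F a x \<and> reachable F y b) \<or> (reachable F a y \<and> reachable F x b)"
      using acyclic_edgesD[OF assms(1) abF] by (metis Diff_subset reachable_mono)
    then show False
      using reachable_edge[OF abF] assms(2) by (meson reachable_sym reachable_trans)
  qed
qed

section \<open>Paths and cycles as vertex lists\<close>

lemma reachable_imp_path:
  assumes "reachable F x y"
  shows "\<exists>p. p \<noteq> [] \<and> hd p = x \<and> last p = y \<and> distinct p \<and> successively (adjacent F) p"
  using assms unfolding reachable_def
proof (induction rule: rtranclp_induct)
  case base
  show ?case by (rule exI[of _ "[x]"]) simp
next
  case (step y z)
  then obtain p where p: "p \<noteq> []" "hd p = x" "last p = y" "distinct p"
      "successively (adjacent F) p"
    by blast
  show ?case
  proof (cases "z \<in> set p")
    case True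
    \<comment> \<open>The walk returns to a vertex of the path, so the path is cut off
      there.\<close>
    then obtain q r where "p = q @ z # r" by (meson split_list)
    with p show ?thesis
      by (intro exI[of _ "q @ [z]"]) (auto simp: successively_append_iff hd_append)
  next
    case False
    with p step.hyps(2) show ?thesis
      by (intro exI[of _ "p @ [z]"]) (auto simp: successively_append_iff)
  qed
qed

lemma path_imp_reachable:
  assumes "successively (adjacent F) p" "p \<noteq> []"
  shows "reachable F (hd p) (last p)"
  using assms
proof (induction p rule: induct_list012)
  case (3 x y zs)
  then have "{x, y} \<in> F" "reachable F y (last (y # zs))"
    by (auto simp: adjacent_def)
  then show ?case
    by (metis last_ConsR list.distinct(1) list.sel(1) reachable_edge reachable_trans)
qed auto

text \<open>An edge that is not a bridge closes a path between its ends to a cycle; conversely, the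
  rest of a cycle connects the ends of its closing edge. The condition on cardinalities excludes
  loops, which \<open>acyclic_edges\<close> rejects but \<open>is_cycle\<close> cannot
  detect.\<close>

lemma no_cycle_iff_acyclic_edges:
  assumes "\<And>e. e \<in> F \<Longrightarrow> card e = 2"
  shows "(\<nexists>c. is_cycle F c) \<longleftrightarrow> acyclic_edges F"
proof
  assume nc: "\<nexists>c. is_cycle F c"
  show "acyclic_edges F"
    unfolding acyclic_edges_def
  proof (intro allI impI notI)
    fix x y assume e: "{x, y} \<in> F" and "reachable (F - {{x, y}}) x y"
    then obtain p where p: "p \<noteq> []" "hd p = x" "last p = y" "distinct p"
        "successively (adjacent (F - {{x, y}})) p"
      using reachable_imp_path by metis
    have "x \<noteq> y" using assms[OF e] by auto
    \<comment> \<open>One vertex would force \<open>x = y\<close>, and two vertices would use the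
      deleted edge.\<close>
    have "length p \<ge> 3"
    proof (rule ccontr)
      assume "\<not> length p \<ge> 3"
      then consider "length p = 0" | "length p = 1" | "length p = 2" by linarith
      then show False
        using p \<open>x \<noteq> y\<close>
        by cases (auto simp: length_Suc_conv adjacent_def numeral_2_eq_2)
    qed
    moreover have "successively (adjacent F) p"
      using p(5) by (rule successively_mono) (auto simp: adjacent_def)
    ultimately have "is_cycle F p"
      using p e by (simp add: is_cycle_def adjacent_def insert_commute)
    then show False using nc by blast
  qed
next
  assume ac: "acyclic_edges F"
  show "\<nexists>c. is_cycle F c"
  proof
    assume "\<exists>c. is_cycle F c"
    then obtain c where c: "length c \<ge> 3" "distinct c" "successively (adjacent F) c"
        "{hd c, last c} \<in> F"
      by (auto simp: is_cycle_def adjacent_def insert_commute)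
    have "successively (adjacent (F - {{hd c, last c}})) c"
      unfolding successively_conv_nth
    proof (intro allI impI)
      fix k assume k: "Suc k < length c"
      have "adjacent F (c ! k) (c ! Suc k)"
        using c(3) k by (simp add: successively_conv_nth)
      \<comment> \<open>No consecutive pair forms the closing edge: as the vertices are distinct,
        \<open>k\<close> and \<open>Suc k\<close> would have to be the first and last index, leaving
        only two vertices.\<close>
      moreover have "{c ! k, c ! Suc k} \<noteq> {c ! 0, c ! (length c - 1)}"
      proof
        have "0 < length c" "length c - 1 < length c" "k < length c"
          using c(1) k by auto
        moreover assume "{c ! k, c ! Suc k} = {c ! 0, c ! (length c - 1)}"
        ultimately have "{k, Suc k} = {0, length c - 1}"
          using nth_eq_iff_index_eq[OF c(2)] k by (auto simp: doubleton_eq_iff)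
        then show False
          using c(1) by (auto simp: doubleton_eq_iff)
      qed
      moreover have "c \<noteq> []" using c(1) by auto
      ultimately show "adjacent (F - {{hd c, last c}}) (c ! k) (c ! Suc k)"
        by (simp add: adjacent_def hd_conv_nth last_conv_nth)
    qed
    then have "reachable (F - {{hd c, last c}}) (hd c) (last c)"
      using c(1) by (intro path_imp_reachable) auto
    then show False
      using acyclic_edgesD[OF ac c(4)] by blast
  qed
qed

section \<open>Spanning trees and separating two-forests\<close>

lemma is_tree_iff:
  "is_tree V F \<longleftrightarrow> connected_graph V F \<and> acyclic_edges F"
proof (cases "connected_graph V F")
  case True
  then have "\<And>e. e \<in> F \<Longrightarrow> card e = 2"
    by (simp add: connected_graph_def simple_graph_def)
  then show ?thesis
    using True no_cycle_iff_acyclic_edges[of F] by (simp add: is_tree_def)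
qed (simp add: is_tree_def)

lemma is_tree_UNIV_iff:
  fixes F :: "'n::finite set set"
  assumes "\<And>e. e \<in> F \<Longrightarrow> card e = 2"
  shows "is_tree UNIV F \<longleftrightarrow> acyclic_edges F \<and> (\<forall>x y. reachable F x y)"
  using assms by (auto simp: is_tree_iff connected_graph_def simple_graph_def)

text \<open>Edges of \<open>F2\<close> have no end in \<open>V1\<close>, so a walk that starts in
  \<open>V1\<close> never uses one. The set \<open>D\<close> of deleted edges makes the fact
  applicable to the bridge condition.\<close>

lemma reachable_Un_stays:
  assumes "simple_graph V1 F1" "simple_graph V2 F2" "V1 \<inter> V2 = {}" "x \<in> V1"
    and "reachable (F1 \<union> F2 - D) x y"
  shows "y \<in> V1 \<and> reachable (F1 - D) x y"
  using assms(5) unfolding reachable_def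
proof (induction rule: rtranclp_induct)
  case base
  then show ?case using assms(4) by simp
next
  case (step y z)
  have "{y, z} \<notin> F2"
    using step.IH assms(2,3) unfolding simple_graph_def by (meson disjoint_iff insert_subset)
  then have e: "{y, z} \<in> F1 - D"
    using step.hyps(2) by (auto simp: adjacent_def)
  then have "z \<in> V1" "adjacent (F1 - D) y z"
    using assms(1) by (auto simp: simple_graph_def adjacent_def)
  with step.IH show ?case by (auto intro: rtranclp.rtrancl_into_rtrancl)
qed

lemma acyclic_edges_Un:
  assumes "simple_graph V1 F1" "simple_graph V2 F2" "V1 \<inter> V2 = {}"
    and "acyclic_edges F1" "acyclic_edges F2"
  shows "acyclic_edges (F1 \<union> F2)"
  unfolding acyclic_edges_def
proof (intro allI impI notI)
  fix x y assume e: "{x, y} \<in> F1 \<union> F2" and r: "reachable (F1 \<union> F2 - {{x, y}}) x y"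
  from e show False
  proof
    assume e1: "{x, y} \<in> F1"
    then have "x \<in> V1" using assms(1) by (auto simp: simple_graph_def)
    from reachable_Un_stays[OF assms(1-3) this r] show False
      using acyclic_edgesD[OF assms(4) e1] by blast
  next
    assume e2: "{x, y} \<in> F2"
    then have "x \<in> V2" using assms(2) by (auto simp: simple_graph_def)
    moreover have "V2 \<inter> V1 = {}" using assms(3) by blast
    moreover have "reachable (F2 \<union> F1 - {{x, y}}) x y" using r by (simp only: Un_commute)
    ultimately have "reachable (F2 - {{x, y}}) x y"
      using reachable_Un_stays[OF assms(2,1)] by blast
    then show False
      using acyclic_edgesD[OF assms(5) e2] by blast
  qed
qed

lemma is_tree_component:
  fixes F :: "'n::finite set set" and i :: 'n
  assumes "\<And>e. e \<in> F \<Longrightarrow> card e = 2" "acyclic_edges F"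
  defines "C \<equiv> {x. reachable F i x}"
  shows "is_tree C {e \<in> F. e \<subseteq> C}"
proof -
  have from_i: "x \<in> C \<and> reachable {e \<in> F. e \<subseteq> C} i x" if "reachable F i x" for x
    using that unfolding reachable_def
  proof (induction rule: rtranclp_induct)
    case base
    then show ?case by (simp add: C_def)
  next
    case (step y z)
    then have "z \<in> C"
      unfolding C_def reachable_def mem_Collect_eq by (meson rtranclp.rtrancl_into_rtrancl)
    with step have "adjacent {e \<in> F. e \<subseteq> C} y z"
      by (simp add: adjacent_def)
    with \<open>z \<in> C\<close> step.IH show ?case
      by (meson rtranclp.rtrancl_into_rtrancl)
  qed
  have "reachable {e \<in> F. e \<subseteq> C} x y" if "x \<in> C" "y \<in> C" for x y
  proof -
    have "reachable F i x" "reachable F i y" using that by (simp_all add: C_def)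
    then show ?thesis
      using reachable_trans[OF reachable_sym[OF conjunct2[OF from_i]] conjunct2[OF from_i]] by blast
  qed
  moreover have "C \<noteq> {}" using from_i[OF reachable_refl] by blast
  moreover have "acyclic_edges {e \<in> F. e \<subseteq> C}"
    using assms(2) by (rule acyclic_edges_subset) auto
  moreover have "simple_graph C {e \<in> F. e \<subseteq> C}"
    using assms(1) by (simp add: simple_graph_def)
  ultimately show ?thesis
    by (simp add: is_tree_iff connected_graph_def)
qed

text \<open>This replaces the existential choice of two trees by conditions on \<open>F\<close>
  alone: the trees must be the components of \<open>i\<close> and \<open>j\<close>.\<close>

lemma separating_two_forest_iff:
  fixes F :: "'n::finite set set"
  assumes "\<And>e. e \<in> F \<Longrightarrow> card e = 2"
  shows "two_forest UNIV F \<and> \<not> reachable F i j \<longleftrightarrow>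
    acyclic_edges F \<and> \<not> reachable F i j \<and> (\<forall>x. reachable F i x \<or> reachable F j x)"
proof safe
  assume "two_forest UNIV F" and nij: "\<not> reachable F i j"
  then obtain V1 V2 F1 F2 where t1: "is_tree V1 F1" and t2: "is_tree V2 F2"
      and dis: "V1 \<inter> V2 = {}" and V: "UNIV = V1 \<union> V2" and F: "F = F1 \<union> F2"
    unfolding two_forest_def by blast
  show "acyclic_edges F"
    unfolding F using t1 t2 dis
    by (intro acyclic_edges_Un[of V1 F1 V2 F2]) (auto simp: is_tree_iff connected_graph_def)
  have r1: "reachable F x y" if "x \<in> V1" "y \<in> V1" for x y
    using that t1 reachable_mono[of F1 F] F by (auto simp: is_tree_def connected_graph_def)
  have r2: "reachable F x y" if "x \<in> V2" "y \<in> V2" for x y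
    using that t2 reachable_mono[of F2 F] F by (auto simp: is_tree_def connected_graph_def)
  fix x assume "\<not> reachable F j x"
  then show "reachable F i x"
    using r1 r2 V nij by (metis UNIV_I UnE)
next
  assume ac: "acyclic_edges F" and nij: "\<not> reachable F i j"
    and all: "\<forall>x. reachable F i x \<or> reachable F j x"
  define V1 V2 where "V1 = {x. reachable F i x}" and "V2 = {x. reachable F j x}"
  have "V1 \<inter> V2 = {}"
    using nij unfolding V1_def V2_def by (metis (mono_tags, lifting) disjoint_iff mem_Collect_eq
      reachable_sym reachable_trans)
  moreover have "UNIV = V1 \<union> V2"
    using all by (auto simp: V1_def V2_def)
  moreover have "F = {e \<in> F. e \<subseteq> V1} \<union> {e \<in> F. e \<subseteq> V2}"
  proof -
    have "e \<subseteq> V1 \<or> e \<subseteq> V2" if e: "e \<in> F" for e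
    proof -
      obtain x y where xy: "e = {x, y}"
        using assms[OF e] by (meson card_2_iff)
      then have "reachable F x y" using e reachable_edge by metis
      then show ?thesis
        using all reachable_trans[of F _ x y] unfolding V1_def V2_def xy by blast
    qed
    then show ?thesis by blast
  qed
  moreover have "is_tree V1 {e \<in> F. e \<subseteq> V1}" "is_tree V2 {e \<in> F. e \<subseteq> V2}"
    unfolding V1_def V2_def by (intro is_tree_component assms ac; assumption)+
  ultimately show "two_forest UNIV F"
    unfolding two_forest_def by (intro exI conjI) assumption+
qed

text \<open>A connected spanning edge set of least cardinality has only bridges, since deleting any
  other edge would keep it connected.\<close>

lemma exists_spanning_tree:
  fixes E :: "'n::finite set set"
  assumes "connected_graph UNIV E"
  shows "spanning_trees UNIV E \<noteq> {}"
proof -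
  let ?P = "\<lambda>T. T \<subseteq> E \<and> (\<forall>x y. reachable T x y)"
  have "?P E" using assms by (auto simp: connected_graph_def)
  then obtain T where T: "?P T" and min: "\<And>T'. ?P T' \<Longrightarrow> card T \<le> card T'"
    using ex_has_least_nat[of ?P E card] by blast
  have "acyclic_edges T"
    unfolding acyclic_edges_def
  proof (intro allI impI notI)
    fix x y assume e: "{x, y} \<in> T" and r: "reachable (T - {{x, y}}) x y"
    have "reachable (T - {{x, y}}) a b" for a b
      using T reachable_remove_cases[of T a b x y] r by (meson reachable_sym reachable_trans)
    then have "card T \<le> card (T - {{x, y}})"
      using min T by blast
    moreover have "card (T - {{x, y}}) < card T"
      using e by (intro psubset_card_mono) auto
    ultimately show False by simp
  qed
  moreover have "card e = 2" if "e \<in> T" for e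
    using that T assms unfolding connected_graph_def simple_graph_def by blast
  ultimately have "is_tree UNIV T"
    using T is_tree_UNIV_iff by blast
  then show ?thesis using T by (auto simp: spanning_trees_def)
qed

section \<open>Kirchhoff's potential\<close>

text \<open>The set holds the second vertex of the tree path from \<open>x\<close> to
  \<open>j\<close>, which exists and is unique unless \<open>x = j\<close>.\<close>

lemma card_tree_first_edge:
  fixes T :: "'n::finite set set"
  assumes ac: "acyclic_edges T" and con: "\<And>x y. reachable T x y"
  shows "card {y. {x, y} \<in> T \<and> reachable (T - {{x, y}}) j y} = (if x = j then 0 else 1)"
    (is "card ?S = _")
proof (cases "x = j")
  case True
  then have "?S = {}" using acyclic_edgesD[OF ac] by blast
  then show ?thesis using True by simp
next
  case False
  \<comment> \<open>Existence: every vertex other than \<open>x\<close> lies in the branch behind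
    some neighbour of \<open>x\<close>.\<close>
  have "z = x \<or> (\<exists>y. {x, y} \<in> T \<and> reachable (T - {{x, y}}) y z)" if "reachable T x z" for z
    using that unfolding reachable_def
  proof (induction rule: rtranclp_induct)
    case base
    then show ?case by simp
  next
    case (step z w)
    consider "w = x" | "z = x" | "z \<noteq> x" "w \<noteq> x" by blast
    then show ?case
    proof cases
      case 2
      then show ?thesis using step.hyps(2) by (auto simp: adjacent_def)
    next
      case 3
      then obtain y where y: "{x, y} \<in> T" "(adjacent (T - {{x, y}}))\<^sup>*\<^sup>* y z"
        using step.IH by blast
      have "adjacent (T - {{x, y}}) z w"
        using step.hyps(2) 3 by (auto simp: adjacent_def doubleton_eq_iff)
      then show ?thesis using y by (meson rtranclp.rtrancl_into_rtrancl)
    qed simp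
  qed
  then obtain y where y: "{x, y} \<in> T" "reachable (T - {{x, y}}) y j"
    using con False by metis
  have "z = y" if z: "{x, z} \<in> T" "reachable (T - {{x, z}}) j z" for z
  proof (rule ccontr)
    assume "z \<noteq> y"
    then have ne: "{x, z} \<noteq> {x, y}" by (simp add: doubleton_eq_iff)
    let ?G = "T - {{x, y}}" and ?H = "T - {{x, y}} - {{x, z}}"
    have xz: "reachable ?G x z"
      using z(1) ne by (intro reachable_edge) simp
    have "\<not> reachable ?G x y" using acyclic_edgesD[OF ac y(1)] .
    then have nx: "\<not> reachable ?G y x" "\<not> reachable ?G y z"
      using xz by (meson reachable_sym reachable_trans)+
    have "?H \<subseteq> ?G" by blast
    then have "\<not> reachable ?H y x" "\<not> reachable ?H y z"
      using nx by (meson reachable_mono)+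
    \<comment> \<open>The branch behind \<open>y\<close> contains neither \<open>x\<close> nor
      \<open>z\<close>, so the walk from \<open>y\<close> to \<open>j\<close> also avoids the edge
      \<open>{x, z}\<close>. Then \<open>x\<close> reaches \<open>z\<close> through \<open>y\<close>
      and \<open>j\<close> without that edge, although it is a bridge.\<close>
    then have "reachable ?H y j"
      using reachable_remove_cases[OF y(2), of x z] by blast
    then have "reachable (T - {{x, z}}) y j"
      by (rule reachable_mono[rotated]) blast
    moreover have "reachable (T - {{x, z}}) x y"
      using y(1) ne by (intro reachable_edge) simp
    ultimately have "reachable (T - {{x, z}}) x z"
      using z(2) by (meson reachable_trans)
    then show False using acyclic_edgesD[OF ac z(1)] by blast
  qed
  then have "?S = {y}"
    using y(1) reachable_sym[OF y(2)] by blast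
  then show ?thesis using False by simp
qed

lemma spanning_trees_iff:
  fixes E :: "'n::finite set set"
  assumes "simple_graph UNIV E"
  shows "T \<in> spanning_trees UNIV E \<longleftrightarrow>
    T \<subseteq> E \<and> acyclic_edges T \<and> (\<forall>x y. reachable T x y)"
proof (cases "T \<subseteq> E")
  case True
  then have "card e = 2" if "e \<in> T" for e
    using that assms unfolding simple_graph_def by blast
  then show ?thesis
    using True by (simp add: spanning_trees_def is_tree_UNIV_iff)
qed (simp add: spanning_trees_def)

lemma separating_two_forests_iff:
  fixes E :: "'n::finite set set"
  assumes "simple_graph UNIV E"
  shows "F \<in> separating_two_forests UNIV E i j \<longleftrightarrow>
    F \<subseteq> E \<and> acyclic_edges F \<and> \<not> reachable F i j \<and> (\<forall>x. reachable F i x \<or> reachable F j x)"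
proof (cases "F \<subseteq> E")
  case True
  then have "card e = 2" if "e \<in> F" for e
    using that assms unfolding simple_graph_def by blast
  then show ?thesis
    using True by (simp add: separating_two_forests_def separating_two_forest_iff)
qed (simp add: separating_two_forests_def)

text \<open>Inserting and deleting \<open>{x, y}\<close> are mutually inverse: the edge joins the
  component of \<open>i\<close> to that of \<open>j\<close>, and its deletion from a tree leaves
  exactly these two components.\<close>

lemma card_forests_eq_card_trees:
  fixes E :: "'n::finite set set"
  assumes E: "simple_graph UNIV E" and e: "{x, y} \<in> E"
  shows "card {F \<in> separating_two_forests UNIV E i j. reachable F i x \<and> reachable F j y} =
    card {T \<in> spanning_trees UNIV E. {x, y} \<in> T \<and>
      reachable (T - {{x, y}}) i x \<and> reachable (T - {{x, y}}) j y}"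
    (is "card ?A = card ?B")
proof (rule bij_betw_same_card,
    rule bij_betw_byWitness[where f = "insert {x, y}" and f' = "\<lambda>T. T - {{x, y}}"])
  have F: "{x, y} \<notin> F \<and> \<not> reachable F x y" if "F \<in> ?A" for F
  proof -
    have "\<not> reachable F i j" "reachable F i x" "reachable F j y"
      using that by (auto simp: separating_two_forests_iff[OF E])
    then have "\<not> reachable F x y"
      by (meson reachable_sym reachable_trans)
    then show ?thesis using reachable_edge by metis
  qed
  then show "\<forall>F\<in>?A. insert {x, y} F - {{x, y}} = F"
    by blast
  show "\<forall>T\<in>?B. insert {x, y} (T - {{x, y}}) = T"
    by blast
  show "insert {x, y} ` ?A \<subseteq> ?B"
  proof (rule image_subsetI)
    fix F assume FA: "F \<in> ?A"
    then have F': "F \<subseteq> E" "acyclic_edges F" "\<And>z. reachable F i z \<or> reachable F j z"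
        "reachable F i x" "reachable F j y"
      by (auto simp: separating_two_forests_iff[OF E])
    let ?T = "insert {x, y} F"
    have up: "reachable ?T a b" if "reachable F a b" for a b
      using that by (rule reachable_mono[rotated]) blast
    have "reachable ?T i x" "reachable ?T j y" "reachable ?T x y"
      using up[OF F'(4)] up[OF F'(5)] reachable_edge[of x y ?T] by simp_all
    then have "reachable ?T i j"
      by (meson reachable_sym reachable_trans)
    then have "reachable ?T i z" for z
      using F'(3)[of z] up[of i z] up[of j z] reachable_trans[of ?T i j z] by blast
    then have "\<forall>a b. reachable ?T a b"
      by (meson reachable_sym reachable_trans)
    moreover have "acyclic_edges ?T"
      using acyclic_edges_insert[OF F'(2)] F[OF FA] by simp
    moreover have "?T - {{x, y}} = F" using F[OF FA] by blast
    ultimately show "?T \<in> ?B"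
      using F'(1,4,5) e by (simp add: spanning_trees_iff[OF E])
  qed
  show "(\<lambda>T. T - {{x, y}}) ` ?B \<subseteq> ?A"
  proof (rule image_subsetI)
    fix T assume "T \<in> ?B"
    then have T: "T \<subseteq> E" "acyclic_edges T" "\<And>a b. reachable T a b" "{x, y} \<in> T"
        "reachable (T - {{x, y}}) i x" "reachable (T - {{x, y}}) j y"
      by (auto simp: spanning_trees_iff[OF E])
    let ?F = "T - {{x, y}}"
    have "\<not> reachable ?F x y" using acyclic_edgesD[OF T(2,4)] .
    then have "\<not> reachable ?F i j"
      using T(5,6) by (meson reachable_sym reachable_trans)
    moreover have "reachable ?F i z \<or> reachable ?F j z" for z
      using reachable_remove_cases[OF T(3)[of i z], of x y] T(5,6)
      by (meson reachable_trans)
    moreover have "acyclic_edges ?F" using T(2) by (rule acyclic_edges_subset) blast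
    ultimately show "?F \<in> ?A"
      using T(1,5,6) by (simp add: separating_two_forests_iff[OF E] subset_iff)
  qed
qed

text \<open>\<open>P x y\<close> says that the tree path from \<open>i\<close> to \<open>j\<close>
  runs through the edge from \<open>x\<close> to \<open>y\<close>, so the sum is the net outflow at
  \<open>x\<close> of a unit flow along this path.\<close>

lemma tree_current:
  fixes T :: "'n::finite set set" and i j :: 'n
  assumes ac: "acyclic_edges T" and con: "\<And>x y. reachable T x y"
  defines "P \<equiv> \<lambda>x y. {x, y} \<in> T \<and> reachable (T - {{x, y}}) i x \<and> reachable (T - {{x, y}}) j y"
  shows "(\<Sum>y\<in>UNIV. of_bool (P x y) - of_bool (P y x) :: real) =
    (if x = i then 1 else 0) - (if x = j then 1 else 0)"
proof -
  \<comment> \<open>\<open>g k y\<close>: the path in \<open>T\<close> from \<open>x\<close> to \<open>k\<close> starts with the edge \<open>xy\<close>\<close>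
  define g where "g \<equiv> \<lambda>k y. {x, y} \<in> T \<and> reachable (T - {{x, y}}) k y"
  have one: "reachable (T - {{x, y}}) k x \<longleftrightarrow> \<not> reachable (T - {{x, y}}) k y"
    if "{x, y} \<in> T" for k y
  proof -
    have "reachable (T - {{x, y}}) k x \<or> reachable (T - {{x, y}}) k y"
      using reachable_remove_cases[OF con[of k x], of x y] by blast
    moreover have "\<not> reachable (T - {{x, y}}) x y"
      using acyclic_edgesD[OF ac that] .
    ultimately show ?thesis by (meson reachable_sym reachable_trans)
  qed
  \<comment> \<open>Deleting \<open>{x, y}\<close> leaves each of \<open>i\<close> and
    \<open>j\<close> on exactly one side, so the net flow through the edge is nonzero only if
    exactly one of them lies behind \<open>y\<close>.\<close>
  have "of_bool (P x y) - of_bool (P y x) = (of_bool (g j y) - of_bool (g i y) :: real)" for y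
    using one[of y i] one[of y j] by (auto simp: P_def g_def insert_commute)
  then have "(\<Sum>y\<in>UNIV. of_bool (P x y) - of_bool (P y x) :: real) =
      real (card {y. g j y}) - real (card {y. g i y})"
    by (simp add: sum_subtractf sum.If_cases of_bool_def)
  also have "\<dots> = (if x = i then 1 else 0) - (if x = j then 1 else 0)"
    unfolding g_def card_tree_first_edge[OF ac con] by simp
  finally show ?thesis .
qed

lemma forest_potential:
  fixes E :: "'n::finite set set" and i j :: 'n
  assumes E: "simple_graph UNIV E"
  defines "v \<equiv> \<lambda>x. real (card {F \<in> separating_two_forests UNIV E i j. reachable F i x})"
  shows "(\<Sum>y | adjacent E x y. v x - v y) =
    real (card (spanning_trees UNIV E)) * ((if x = i then 1 else 0) - (if x = j then 1 else 0))"
proof -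
  let ?S = "separating_two_forests UNIV E i j" and ?ST = "spanning_trees UNIV E"
  define P where "P \<equiv> \<lambda>T x y. {x, y} \<in> T \<and>
      reachable (T - {{x, y}}) i x \<and> reachable (T - {{x, y}}) j y"
  define A where "A \<equiv> \<lambda>x y. real (card {F \<in> ?S. reachable F i x \<and> reachable F j y})"
  define C where "C \<equiv> \<lambda>x y. real (card {F \<in> ?S. reachable F i x \<and> reachable F i y})"
  \<comment> \<open>\<open>A\<close> counts the forests with \<open>x\<close> on the side of
    \<open>i\<close> and \<open>y\<close> on that of \<open>j\<close>, and \<open>C\<close> those
    with both on the side of \<open>i\<close>. As \<open>C\<close> is symmetric, it cancels in
    \<open>v x - v y\<close>.\<close>
  have v_split: "v x = C x y + A x y" for x y
  proof -
    have "reachable F j y \<longleftrightarrow> \<not> reachable F i y" if "F \<in> ?S" for F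
      using that unfolding separating_two_forests_iff[OF E] by (meson reachable_sym reachable_trans)
    then have "{F \<in> ?S. reachable F i x} = {F \<in> ?S. reachable F i x \<and> reachable F i y} \<union>
        {F \<in> ?S. reachable F i x \<and> reachable F j y}"
      and "{F \<in> ?S. reachable F i x \<and> reachable F i y} \<inter>
        {F \<in> ?S. reachable F i x \<and> reachable F j y} = {}"
      by blast+
    then show ?thesis
      by (simp add: v_def A_def C_def card_Un_disjoint)
  qed
  have A_trees: "A x y = (\<Sum>T\<in>?ST. of_bool (P T x y))" if "{x, y} \<in> E" for x y
    unfolding A_def card_forests_eq_card_trees[OF E that]
    by (simp add: P_def of_bool_def sum.If_cases Int_def)
  have "v x - v y = (\<Sum>T\<in>?ST. of_bool (P T x y) - of_bool (P T y x))" if "adjacent E x y" for y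
  proof -
    have "{x, y} \<in> E" "{y, x} \<in> E"
      using that by (simp_all add: adjacent_def insert_commute)
    moreover have "C x y = C y x" by (simp add: C_def conj_commute)
    ultimately show ?thesis
      using v_split[of x y] v_split[of y x] by (simp add: A_trees sum_subtractf)
  qed
  then have "(\<Sum>y | adjacent E x y. v x - v y) =
      (\<Sum>y | adjacent E x y. \<Sum>T\<in>?ST. of_bool (P T x y) - of_bool (P T y x))"
    by simp
  also have "\<dots> = (\<Sum>T\<in>?ST. \<Sum>y | adjacent E x y. of_bool (P T x y) - of_bool (P T y x))"
    by (rule sum.swap)
  also have "\<dots> = (\<Sum>T\<in>?ST. (if x = i then 1 else 0) - (if x = j then 1 else 0))"
  proof (rule sum.cong)
    fix T assume "T \<in> ?ST"
    then have T: "T \<subseteq> E" "acyclic_edges T" "\<And>a b. reachable T a b"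
      by (auto simp: spanning_trees_iff[OF E])
    \<comment> \<open>The sum may run over all vertices because \<open>P T\<close> only holds along
      edges of \<open>T\<close>, which belong to \<open>E\<close>.\<close>
    have "(\<Sum>y | adjacent E x y. of_bool (P T x y) - of_bool (P T y x) :: real) =
        (\<Sum>y\<in>UNIV. of_bool (P T x y) - of_bool (P T y x))"
      using T(1) by (intro sum.mono_neutral_left) (auto simp: adjacent_def P_def insert_commute)
    also have "\<dots> = (if x = i then 1 else 0) - (if x = j then 1 else 0)"
      unfolding P_def using tree_current[OF T(2,3)] .
    finally show "(\<Sum>y | adjacent E x y. of_bool (P T x y) - of_bool (P T y x) :: real) =
        (if x = i then 1 else 0) - (if x = j then 1 else 0)" .
  qed simp
  finally show ?thesis by simp
qed

section \<open>The Moore--Penrose inverse of the Laplacian\<close>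

text \<open>Inserting \<open>A = A ** Y ** A\<close> and transposing gives
  \<open>A ** X = A ** Y\<close> and \<open>X ** A = Y ** A\<close>. Hence
  \<open>X = X ** A ** X = Y ** A ** X = Y ** A ** Y = Y\<close>.\<close>

lemma moore_penrose_unique:
  assumes X: "is_moore_penrose A X" and Y: "is_moore_penrose A Y"
  shows "X = Y"
proof -
  have AX: "A ** X = A ** Y"
  proof -
    have "A ** X = transpose (A ** X)" using X by (simp add: is_moore_penrose_def)
    also have "\<dots> = transpose ((A ** Y) ** (A ** X))"
      using Y by (simp add: is_moore_penrose_def matrix_mul_assoc)
    also have "\<dots> = transpose (A ** X) ** transpose (A ** Y)"
      by (rule matrix_transpose_mul)
    also have "\<dots> = A ** X ** A ** Y"
      using X Y by (simp add: is_moore_penrose_def matrix_mul_assoc)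
    also have "\<dots> = A ** Y" using X by (simp add: is_moore_penrose_def)
    finally show ?thesis .
  qed
  have XA: "X ** A = Y ** A"
  proof -
    have "X ** A = transpose (X ** A)" using X by (simp add: is_moore_penrose_def)
    also have "\<dots> = transpose ((X ** A) ** (Y ** A))"
      using Y by (metis is_moore_penrose_def matrix_mul_assoc)
    also have "\<dots> = transpose (Y ** A) ** transpose (X ** A)"
      by (rule matrix_transpose_mul)
    also have "\<dots> = Y ** (A ** X ** A)"
      using X Y by (metis is_moore_penrose_def matrix_mul_assoc)
    also have "\<dots> = Y ** A" using X by (simp add: is_moore_penrose_def)
    finally show ?thesis .
  qed
  have "X = X ** A ** X" using X by (simp add: is_moore_penrose_def)
  also have "\<dots> = Y ** (A ** X)" by (simp add: XA matrix_mul_assoc)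
  also have "\<dots> = Y" using Y by (simp add: AX is_moore_penrose_def matrix_mul_assoc)
  finally show ?thesis .
qed

lemma moore_penrose_eqI: "is_moore_penrose A X \<Longrightarrow> moore_penrose A = X"
  unfolding moore_penrose_def by (blast intro: the_equality moore_penrose_unique)

text \<open>This translates between matrix equations for the Laplacian and Kirchhoff's current
  law.\<close>

lemma laplacian_mult_vec:
  fixes E :: "'n::finite set set"
  assumes "simple_graph UNIV E"
  shows "(laplacian E *v w) $ x = (\<Sum>y | adjacent E x y. w $ x - w $ y)"
proof -
  have "(laplacian E *v w) $ x =
      (\<Sum>y\<in>UNIV. (if x = y then real (card {z. adjacent E x z}) else 0) * w $ y) -
      (\<Sum>y\<in>UNIV. (if adjacent E x y then 1 else 0) * w $ y)"
    by (simp add: laplacian_def degree_matrix_def adjacency_matrix_def matrix_vector_mult_def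
        left_diff_distrib sum_subtractf)
  also have "\<dots> = real (card {z. adjacent E x z}) * w $ x - (\<Sum>y | adjacent E x y. w $ y)"
    by (simp add: if_distrib[of "\<lambda>a. a * _"] sum.If_cases cong: if_cong)
  also have "\<dots> = (\<Sum>y | adjacent E x y. w $ x - w $ y)"
    by (simp add: sum_subtractf)
  finally show ?thesis .
qed

lemma transpose_laplacian: "transpose (laplacian E) = laplacian E"
  by (auto simp: vec_eq_iff transpose_def laplacian_def degree_matrix_def adjacency_matrix_def
      adjacent_commute)

text \<open>Maximum principle: where \<open>w\<close> is maximal all summands are nonnegative, so
  they vanish and every neighbour attains the maximum too. Connectedness spreads this to all
  vertices.\<close>

lemma harmonic_constant:
  fixes E :: "'n::finite set set" and w :: "'n \<Rightarrow> real"
  assumes "connected_graph UNIV E" and harm: "\<And>x. (\<Sum>y | adjacent E x y. w x - w y) = 0"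
  shows "w x = w y"
proof -
  define m where "m = Max (range w)"
  have le: "w z \<le> m" for z by (simp add: m_def)
  have "m \<in> range w" unfolding m_def by (intro Max_in) auto
  then obtain a where a: "w a = m" by auto
  have "w z = m" for z
  proof -
    have "reachable E a z" using assms(1) by (simp add: connected_graph_def)
    then show ?thesis unfolding reachable_def
    proof (induction rule: rtranclp_induct)
      case (step b c)
      have "\<forall>y\<in>{y. adjacent E b y}. w b - w y = 0"
        using harm[of b] step.IH le by (subst (asm) sum_nonneg_eq_0_iff) auto
      then show ?case using step by auto
    qed (rule a)
  qed
  then show ?thesis by simp
qed

section \<open>Matrix algebra and the averaging projection\<close>

lemma matrix_vector_mult_const:
  "(\<chi> x y. c) *v w = (\<chi> x. c * (\<Sum>y\<in>UNIV. w $ y))"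
  by (simp add: matrix_vector_mult_def vec_eq_iff sum_distrib_left)

lemma transpose_add: "transpose (A + B) = transpose A + transpose B"
  by (simp add: transpose_def vec_eq_iff)

lemma transpose_diff:
  fixes A B :: "'a::ab_group_add^'n^'m"
  shows "transpose (A - B) = transpose A - transpose B"
  by (simp add: transpose_def vec_eq_iff)

lemma matrix_add_rdistrib: "(A + B) ** C = A ** C + B ** C"
  by (simp add: matrix_matrix_mult_def vec_eq_iff distrib_right sum.distrib)

lemma matrix_diff_ldistrib:
  fixes A :: "'a::ring_1^'n^'m"
  shows "A ** (B - C) = A ** B - A ** C"
  by (simp add: matrix_matrix_mult_def vec_eq_iff right_diff_distrib sum_subtractf)

lemma matrix_diff_rdistrib:
  fixes A B :: "'a::ring_1^'n^'m"
  shows "(A - B) ** C = A ** C - B ** C"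
  by (simp add: matrix_matrix_mult_def vec_eq_iff left_diff_distrib sum_subtractf)

text \<open>The matrix \<open>J/n\<close>, the orthogonal projection onto the constant vectors,
  which form the kernel of the Laplacian of a connected graph.\<close>

definition averaging :: "real^'n^'n::finite" where
  "averaging = (\<chi> x y. 1 / real CARD('n))"

lemma transpose_averaging: "transpose averaging = averaging"
  by (simp add: transpose_def averaging_def)

lemma averaging_idem: "averaging ** averaging = (averaging :: real^'n^'n::finite)"
  by (simp add: averaging_def matrix_matrix_mult_def vec_eq_iff)

text \<open>Since \<open>L + J/n\<close> is invertible, the Moore--Penrose inverse of the Laplacian \<open>L\<close> is
  \<open>(L + J/n)\<^sup>-\<^sup>1 - J/n\<close>.\<close>

lemma laplacian_moore_penrose:
  fixes E :: "'n::finite set set"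
  assumes con: "connected_graph UNIV E"
  obtains X where "moore_penrose (laplacian E) = X" "transpose X = X"
    "laplacian E ** X = mat 1 - averaging" "X ** averaging = 0"
proof -
  let ?L = "laplacian E" and ?P = "averaging :: real^'n^'n"
  have E: "simple_graph UNIV E" using con by (simp add: connected_graph_def)
  have "?L *v (?P *v w) = 0" for w
    by (simp add: vec_eq_iff laplacian_mult_vec[OF E] averaging_def matrix_vector_mult_const)
  then have LP: "?L ** ?P = 0"
    unfolding matrix_eq by (simp flip: matrix_vector_mul_assoc)
  have "?P ** ?L = transpose (?L ** ?P)"
    by (simp add: matrix_transpose_mul transpose_laplacian transpose_averaging)
  then have PL: "?P ** ?L = 0"
    by (simp add: LP transpose_def vec_eq_iff)
  \<comment> \<open>Multiplying by \<open>?P\<close> gives \<open>?P *v w = 0\<close>, hence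
    \<open>?L *v w = 0\<close>. So \<open>w\<close> is constant with mean zero.\<close>
  have kernel: "w = 0" if "(?L + ?P) *v w = 0" for w
  proof -
    have "?P *v w = (?P ** (?L + ?P)) *v w"
      by (simp add: matrix_add_ldistrib PL averaging_idem)
    also have "\<dots> = 0" by (simp add: that flip: matrix_vector_mul_assoc)
    finally have Pw: "?P *v w = 0" .
    then have "?L *v w = 0" using that by (simp add: matrix_vector_mult_add_rdistrib)
    then have "w $ x = w $ y" for x y
      by (intro harmonic_constant[OF con]) (simp flip: laplacian_mult_vec[OF E])
    then obtain c where c: "\<And>x. w $ x = c" by blast
    have "c = 0"
      using Pw by (simp add: vec_eq_iff averaging_def matrix_vector_mult_const c)
    then show "w = 0" using c by (simp add: vec_eq_iff)
  qed
  then obtain M where MI: "M ** (?L + ?P) = mat 1"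
    using matrix_left_invertible_ker by blast
  then have IM: "(?L + ?P) ** M = mat 1" by (simp add: matrix_left_right_inverse)
  define X where "X = M - ?P"
  have tM: "transpose M = M"
  proof -
    \<comment> \<open>As \<open>?L + ?P\<close> is symmetric, the transpose of its inverse is again
      an inverse.\<close>
    have "transpose M ** (?L + ?P) = mat 1"
      using arg_cong[OF IM, of transpose]
      by (simp add: matrix_transpose_mul transpose_mat transpose_laplacian transpose_averaging
          transpose_add)
    then show ?thesis using IM MI by (metis matrix_mul_assoc matrix_mul_lid matrix_mul_rid)
  qed
  have "?P = (?P ** (?L + ?P)) ** M"
    by (simp add: IM flip: matrix_mul_assoc)
  then have PM: "?P ** M = ?P"
    by (simp add: matrix_add_ldistrib PL averaging_idem)
  have "?P = M ** ((?L + ?P) ** ?P)"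
    by (simp add: MI matrix_mul_assoc)
  then have MP: "M ** ?P = ?P"
    by (simp add: matrix_add_rdistrib LP averaging_idem)
  have XP: "X ** ?P = 0"
    by (simp add: X_def matrix_diff_rdistrib MP averaging_idem)
  have LX: "?L ** X = mat 1 - ?P"
    using IM by (simp add: X_def matrix_diff_ldistrib matrix_add_rdistrib PM LP algebra_simps)
  have XL: "X ** ?L = mat 1 - ?P"
    using MI by (simp add: X_def matrix_diff_rdistrib matrix_add_ldistrib MP PL algebra_simps)
  have tX: "transpose X = X"
    by (simp add: X_def transpose_diff tM transpose_averaging)
  have "is_moore_penrose ?L X"
    unfolding is_moore_penrose_def
  proof (intro conjI)
    show "?L ** X ** ?L = ?L"
      by (simp add: LX matrix_diff_rdistrib PL)
    show "X ** ?L ** X = X"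
      by (simp add: LX matrix_diff_ldistrib XP flip: matrix_mul_assoc)
    show "transpose (?L ** X) = ?L ** X" "transpose (X ** ?L) = X ** ?L"
      by (simp_all add: LX XL transpose_diff transpose_mat transpose_averaging)
  qed
  then have "moore_penrose ?L = X" by (rule moore_penrose_eqI)
  with that tX LX XP show thesis by blast
qed

section \<open>Resistance distances\<close>

text \<open>Two potentials for the same current differ by a harmonic function, which is constant, so
  the potential difference is well defined.\<close>

lemma resistance_distance_eqI:
  fixes E :: "'n::finite set set"
  assumes "connected_graph UNIV E" "unit_current_potential E i j v"
  shows "resistance_distance E i j = v i - v j"
  unfolding resistance_distance_def
proof (rule the_equality)
  show "\<exists>u. unit_current_potential E i j u \<and> v i - v j = u i - u j"
    using assms(2) by blast
  fix r assume "\<exists>u. unit_current_potential E i j u \<and> r = u i - u j"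
  then obtain u where u: "unit_current_potential E i j u" "r = u i - u j" by blast
  have "(\<Sum>y | adjacent E x y. (u x - v x) - (u y - v y)) =
      (\<Sum>y | adjacent E x y. u x - u y) - (\<Sum>y | adjacent E x y. v x - v y)" for x
    unfolding sum_subtractf[symmetric] by (rule sum.cong) auto
  then have "(\<Sum>y | adjacent E x y. (u x - v x) - (u y - v y)) = 0" for x
    using assms(2) u(1) by (simp add: unit_current_potential_def)
  then have "u i - v i = u j - v j"
    by (rule harmonic_constant[OF assms(1)])
  then show "r = v i - v j" using u(2) by simp
qed

lemma resistance_distance_moore_penrose:
  fixes E :: "'n::finite set set"
  assumes con: "connected_graph UNIV E"
  defines "X \<equiv> moore_penrose (laplacian E)"
  shows "resistance_distance E i j = X $ i $ i + X $ j $ j - 2 * X $ i $ j"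
proof -
  have E: "simple_graph UNIV E" using con by (simp add: connected_graph_def)
  have tX: "transpose X = X" and LX: "laplacian E ** X = mat 1 - averaging"
    using laplacian_moore_penrose[OF con] unfolding X_def by metis+
  have sym: "X $ a $ b = X $ b $ a" for a b
    using arg_cong[OF tX, of "\<lambda>M. M $ b $ a"] by (simp add: transpose_def)
  have column: "(\<Sum>y | adjacent E x y. X $ x $ c - X $ y $ c) =
      (if x = c then 1 else 0) - 1 / real CARD('n)" for x c
  proof -
    have "(\<Sum>y | adjacent E x y. X $ x $ c - X $ y $ c) = (laplacian E *v column c X) $ x"
      by (simp add: laplacian_mult_vec[OF E] column_def)
    also have "\<dots> = (laplacian E ** X) $ x $ c"
      by (simp add: matrix_vector_mult_def matrix_matrix_mult_def column_def)
    also have "\<dots> = (if x = c then 1 else 0) - 1 / real CARD('n)"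
      by (simp add: LX mat_def averaging_def)
    finally show ?thesis .
  qed
  \<comment> \<open>The potential is the difference of columns \<open>i\<close> and \<open>j\<close>
    of \<open>X\<close>; the terms \<open>1/n\<close> from the averaging matrix cancel in its
    currents.\<close>
  have "unit_current_potential E i j (\<lambda>x. X $ x $ i - X $ x $ j)"
    unfolding unit_current_potential_def
  proof
    fix x
    have "(\<Sum>y | adjacent E x y. (X $ x $ i - X $ x $ j) - (X $ y $ i - X $ y $ j)) =
        (\<Sum>y | adjacent E x y. X $ x $ i - X $ y $ i) - (\<Sum>y | adjacent E x y. X $ x $ j - X $ y $ j)"
      unfolding sum_subtractf[symmetric] by (rule sum.cong) auto
    then show "(\<Sum>y | adjacent E x y. (X $ x $ i - X $ x $ j) - (X $ y $ i - X $ y $ j)) =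
        (if x = i then 1 else 0) - (if x = j then 1 else 0)"
      unfolding column by simp
  qed
  from resistance_distance_eqI[OF con this] show ?thesis
    using sym[of j i] by simp
qed

lemma resistance_distance_forests:
  fixes E :: "'n::finite set set"
  assumes con: "connected_graph UNIV E"
  shows "resistance_distance E i j =
    real (card (separating_two_forests UNIV E i j)) / real (card (spanning_trees UNIV E))"
proof -
  have E: "simple_graph UNIV E" using con by (simp add: connected_graph_def)
  let ?S = "separating_two_forests UNIV E i j"
  let ?t = "real (card (spanning_trees UNIV E))"
  define v where "v \<equiv> \<lambda>x. real (card {F \<in> ?S. reachable F i x})"
  have t: "?t \<noteq> 0" using exists_spanning_tree[OF con] by simp
  have "unit_current_potential E i j (\<lambda>x. v x / ?t)"
    unfolding unit_current_potential_def
    using forest_potential[OF E, of i j] t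
    by (simp add: v_def flip: diff_divide_distrib sum_divide_distrib)
  from resistance_distance_eqI[OF con this]
  have "resistance_distance E i j = (v i - v j) / ?t"
    by (simp add: diff_divide_distrib)
  \<comment> \<open>At \<open>i\<close> the potential counts all separating forests, at
    \<open>j\<close> none.\<close>
  moreover have "{F \<in> ?S. reachable F i i} = ?S" "{F \<in> ?S. reachable F i j} = {}"
    by (auto simp: separating_two_forests_def)
  ultimately show ?thesis by (simp add: v_def)
qed

section \<open>Entries of the inverse under resistance regularity\<close>

theorem theorem2p21:
  fixes E :: "'n::finite set set" and k :: real and i j :: 'n
  assumes "resistance_regular k E"
  shows "moore_penrose (laplacian E) $ i $ j =
    1 / 2 * (k / real CARD('n) -
      real (card (separating_two_forests UNIV E i j)) / real (card (spanning_trees UNIV E)))"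
proof -
  let ?n = "real CARD('n)"
  define X where "X = moore_penrose (laplacian E)"
  have con: "connected_graph UNIV E"
    using assms by (simp add: resistance_regular_def)
  have r: "resistance_distance E a b = X $ a $ a + X $ b $ b - 2 * X $ a $ b" for a b
    unfolding X_def by (rule resistance_distance_moore_penrose[OF con])
  have "X ** averaging = 0"
    using laplacian_moore_penrose[OF con] unfolding X_def by metis
  then have "(X ** averaging) $ a $ a = 0" for a by simp
  then have rows: "(\<Sum>b\<in>UNIV. X $ a $ b) = 0" for a
    by (simp add: matrix_matrix_mult_def averaging_def flip: sum_divide_distrib)
  define tr where "tr = (\<Sum>b\<in>UNIV. X $ b $ b)"
  \<comment> \<open>Summing the resistances from \<open>a\<close> to all vertices, the mixed terms
    vanish because the rows of \<open>X\<close> sum to zero.\<close>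
  have diag: "?n * X $ a $ a = k - tr" for a
  proof -
    have "k = (\<Sum>b\<in>UNIV. resistance_distance E a b)"
      using assms by (simp add: resistance_regular_def resistance_matrix_def)
    also have "\<dots> = ?n * X $ a $ a + tr"
      by (simp add: r tr_def sum.distrib sum_subtractf rows flip: sum_distrib_left)
    finally show ?thesis by simp
  qed
  \<comment> \<open>Summing \<open>diag\<close> over all vertices determines the trace.\<close>
  have "?n * tr = (\<Sum>a\<in>UNIV. ?n * X $ a $ a)"
    by (simp add: tr_def sum_distrib_left)
  also have "\<dots> = ?n * (k - tr)"
    by (simp add: diag)
  finally have "tr = k / 2" by simp
  then have "X $ a $ a = k / (2 * ?n)" for a
    using diag[of a] by (simp add: field_simps)
  then have "X $ i $ j = 1 / 2 * (k / ?n - resistance_distance E i j)"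
    by (simp add: r)
  then show ?thesis
    by (simp add: X_def resistance_distance_forests[OF con])
qed

end
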